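(* For any potential function $U$, the ensemble's mean velocity $$\bar p(t)=\frac1N\sum_{n=1}^Np_n(t),\qquad t\in[0,\infty),$$ is a Brownian motion (started at $\bar p(0)$) with variance $\sigma^2/N$; in fact $$d\bar p(t)=\frac{\sigma}{N}\sum_{n=1}^NdW_n(t),\qquad t\in[0,\infty).$$
   Context: $N\ge3$ is an integer, $\beta\in(0,\infty)$, $\sigma\in\mathbb{R}$, $U\in C^1(\mathbb{R},[0,\infty))$ is convex, and $W=(W_n)_{n=1}^N$ is an $N$-dimensional standard Brownian motion. $(Q,p)=((Q_n)_{n=1}^N,(p_n)_{n=1}^N)$ is a solution on $[0,\infty)$ of the system $$dQ_n(t)=\bigl(p_{n+1}(t)-p_n(t)\bigr)\,dt,\qquad Q(0)=Q_0\in[0,\infty)^N,$$ $$dp_n(t)=\bigl(U'(Q_n(t))-U'(Q_{n-1}(t))\bigr)\,dt+\beta\bigl(p_{n+1}(t)-2p_n(t)+p_{n-1}(t)\bigr)\,dt+\sigma\,dW_n(t),\qquad p(0)=p_0\in\mathbb{R}^N,$$ $n\in\{1,\dots,N\}$, with cyclic indices ($n+1$ means $1$ if $n=N$, $n-1$ means $N$ if $n=1$) and deterministic $Q_0,p_0$. "Brownian motion with variance $\sigma^2/N$" means that $\bar p(t)-\bar p(0)$ is $\sigma/\sqrt N$ times a standard one-dimensional Brownian motion. *)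

theory Defs
  imports "HOL-Probability.Probability"
begin

text \<open>
  Processes are functions of time and outcome, considered at times \<open>t \<ge> 0\<close> only. Families
  \<open>(X\<^sub>n)\<close> with \<open>1 \<le> n \<le> N\<close> are functions on \<^typ>\<open>nat\<close> considered on \<open>{1..N}\<close> only.
\<close>

definition standard_brownian_motion :: "'a measure \<Rightarrow> (real \<Rightarrow> 'a \<Rightarrow> real) \<Rightarrow> bool" where
  "standard_brownian_motion M B \<longleftrightarrow>
     prob_space M \<and>
     (\<forall>t\<ge>0. B t \<in> borel_measurable M) \<and>
     (AE \<omega> in M. B 0 \<omega> = 0) \<and>
     (\<forall>(m::nat) \<tau>. 0 \<le> \<tau> 0 \<and> (\<forall>i<m. \<tau> i \<le> \<tau> (Suc i)) \<longrightarrow>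
        prob_space.indep_vars M (\<lambda>_. borel) (\<lambda>i \<omega>. B (\<tau> (Suc i)) \<omega> - B (\<tau> i) \<omega>) {..<m}) \<and>
     (\<forall>s t. 0 \<le> s \<and> s < t \<longrightarrow>
        distributed M lborel (\<lambda>\<omega>. B t \<omega> - B s \<omega>) (normal_density 0 (sqrt (t - s)))) \<and>
     (AE \<omega> in M. continuous_on {0..} (\<lambda>t. B t \<omega>))"

text \<open>
  The components are independent as processes: the random paths, viewed as elements of the
  product space over the time axis, are independent.
\<close>

definition standard_brownian_motion_dim ::
    "'a measure \<Rightarrow> nat \<Rightarrow> (nat \<Rightarrow> real \<Rightarrow> 'a \<Rightarrow> real) \<Rightarrow> bool" where
  "standard_brownian_motion_dim M N W \<longleftrightarrow>
     (\<forall>n\<in>{1..N}. standard_brownian_motion M (W n)) \<and>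
     prob_space.indep_vars M (\<lambda>_. PiM {0..} (\<lambda>_. borel))
       (\<lambda>n \<omega>. \<lambda>t\<in>{0..}. W n t \<omega>) {1..N}"

definition cyc_next :: "nat \<Rightarrow> nat \<Rightarrow> nat" where
  "cyc_next N n = (if n = N then 1 else n + 1)"

definition cyc_prev :: "nat \<Rightarrow> nat \<Rightarrow> nat" where
  "cyc_prev N n = (if n = 1 then N else n - 1)"

text \<open>
  A solution consists of random variables whose paths are almost surely continuous and almost
  surely satisfy the integrated equations at all times. The noise is additive, so its stochastic
  integral over \<open>[0, t]\<close> is \<open>\<sigma> (W\<^sub>n(t) - W\<^sub>n(0))\<close> and no filtration is involved.
\<close>

definition solves_chain_system ::
    "'a measure \<Rightarrow> nat \<Rightarrow> real \<Rightarrow> real \<Rightarrow> (real \<Rightarrow> real) \<Rightarrow> (nat \<Rightarrow> real \<Rightarrow> 'a \<Rightarrow> real) \<Rightarrow>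
     (nat \<Rightarrow> real) \<Rightarrow> (nat \<Rightarrow> real) \<Rightarrow>
     (nat \<Rightarrow> real \<Rightarrow> 'a \<Rightarrow> real) \<Rightarrow> (nat \<Rightarrow> real \<Rightarrow> 'a \<Rightarrow> real) \<Rightarrow> bool" where
  "solves_chain_system M N \<beta> \<sigma> U W Q0 p0 Q p \<longleftrightarrow>
     (\<forall>n\<in>{1..N}. \<forall>t\<ge>0. Q n t \<in> borel_measurable M \<and> p n t \<in> borel_measurable M) \<and>
     (AE \<omega> in M. \<forall>n\<in>{1..N}.
        continuous_on {0..} (\<lambda>t. Q n t \<omega>) \<and> continuous_on {0..} (\<lambda>t. p n t \<omega>) \<and>
        Q n 0 \<omega> = Q0 n \<and> p n 0 \<omega> = p0 n \<and>
        (\<forall>t\<ge>0.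
           Q n t \<omega> = Q n 0 \<omega> + integral {0..t} (\<lambda>s. p (cyc_next N n) s \<omega> - p n s \<omega>) \<and>
           p n t \<omega> = p n 0 \<omega>
             + integral {0..t} (\<lambda>s. deriv U (Q n s \<omega>) - deriv U (Q (cyc_prev N n) s \<omega>))
             + integral {0..t} (\<lambda>s. \<beta> * (p (cyc_next N n) s \<omega> - 2 * p n s \<omega>
                                           + p (cyc_prev N n) s \<omega>))
             + \<sigma> * (W n t \<omega> - W n 0 \<omega>)))"

definition mean_velocity ::
    "nat \<Rightarrow> (nat \<Rightarrow> real \<Rightarrow> 'a \<Rightarrow> real) \<Rightarrow> real \<Rightarrow> 'a \<Rightarrow> real" where
  "mean_velocity N p t \<omega> = (1 / real N) * (\<Sum>n=1..N. p n t \<omega>)"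

end

theory Submission
  imports Defs
begin

text \<open>
  The interaction and damping terms telescope around the cycle, so summing the integrated
  equations leaves only the noise, and $\bar p(t) - \bar p(0) = \frac{\sigma}{N} \sum_n (W_n(t) - W_n(0))$.
  It remains to see that $N^{-1/2} \sum_n (W_n(t) - W_n(0))$ is a standard Brownian motion.
  Independence of its increments is the only delicate point: independence of the components as
  processes, together with independent increments of each one, makes all the increments
  $W_n(\tau_{i+1}) - W_n(\tau_i)$ jointly independent over the pairs $(n, i)$, and these
  may then be regrouped by $i$.
\<close>

lemma bij_betw_cyc_next:
  assumes "N \<ge> 1"
  shows "bij_betw (cyc_next N) {1..N} {1..N}"
  using assms
  by (intro bij_betw_byWitness[where f' = "cyc_prev N"]) (auto simp: cyc_next_def cyc_prev_def)

lemma bij_betw_cyc_prev: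
  assumes "N \<ge> 1"
  shows "bij_betw (cyc_prev N) {1..N} {1..N}"
  using assms
  by (intro bij_betw_byWitness[where f' = "cyc_next N"]) (auto simp: cyc_next_def cyc_prev_def)

lemma sum_cyc_next: "N \<ge> 1 \<Longrightarrow> (\<Sum>n=1..N. f (cyc_next N n)) = (\<Sum>n=1..N. f n)"
  by (rule sum.reindex_bij_betw[OF bij_betw_cyc_next])

lemma sum_cyc_prev: "N \<ge> 1 \<Longrightarrow> (\<Sum>n=1..N. f (cyc_prev N n)) = (\<Sum>n=1..N. f n)"
  by (rule sum.reindex_bij_betw[OF bij_betw_cyc_prev])

lemma sum_integral_eq_0:
  fixes f :: "'i \<Rightarrow> real \<Rightarrow> real"
  assumes "\<And>n. n \<in> I \<Longrightarrow> continuous_on {a..b} (f n)"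
    and "\<And>s. s \<in> {a..b} \<Longrightarrow> (\<Sum>n\<in>I. f n s) = 0"
  shows "(\<Sum>n\<in>I. integral {a..b} (f n)) = 0"
proof (cases "finite I")
  case True
  then have "(\<Sum>n\<in>I. integral {a..b} (f n)) = integral {a..b} (\<lambda>s. \<Sum>n\<in>I. f n s)"
    using assms(1) by (intro integral_sum[symmetric] integrable_continuous_real)
  also have "\<dots> = integral {a..b} (\<lambda>s. 0)"
    by (rule integral_cong) (rule assms(2))
  finally show ?thesis by simp
\<comment> \<open>For infinite \<open>I\<close> the sum is 0 by convention.\<close>
qed simp

text \<open>A deterministic statement about one outcome at one time: \<open>V\<close> stands for the
  derivative of the potential and \<open>w\<close> for a path of the noise. Both cyclic shifts
  permute the indices, so each drift integrand sums to zero over the cycle at every instant;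
  continuity lets the sum pass under the integral.\<close>

lemma chain_sum_velocity:
  fixes Q p w :: "nat \<Rightarrow> real \<Rightarrow> real" and V :: "real \<Rightarrow> real"
  assumes "N \<ge> 1" and V: "continuous_on UNIV V"
    and Q: "\<And>n. n \<in> {1..N} \<Longrightarrow> continuous_on {0..t} (Q n)"
    and p: "\<And>n. n \<in> {1..N} \<Longrightarrow> continuous_on {0..t} (p n)"
    and eq: "\<And>n. n \<in> {1..N} \<Longrightarrow> p n t = p n 0
             + integral {0..t} (\<lambda>s. V (Q n s) - V (Q (cyc_prev N n) s))
             + integral {0..t} (\<lambda>s. \<beta> * (p (cyc_next N n) s - 2 * p n s + p (cyc_prev N n) s))
             + \<sigma> * (w n t - w n 0)"
  shows "(\<Sum>n=1..N. p n t) - (\<Sum>n=1..N. p n 0) = \<sigma> * (\<Sum>n=1..N. w n t - w n 0)"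
proof -
  have next_in: "cyc_next N n \<in> {1..N}" and prev_in: "cyc_prev N n \<in> {1..N}" if "n \<in> {1..N}" for n
    using that by (auto simp: cyc_next_def cyc_prev_def)
  have VQ: "continuous_on {0..t} (\<lambda>s. V (Q n s))" if "n \<in> {1..N}" for n
    by (rule continuous_on_compose2[OF V Q[OF that]]) simp
  have force: "(\<Sum>n=1..N. integral {0..t} (\<lambda>s. V (Q n s) - V (Q (cyc_prev N n) s))) = 0"
    using sum_cyc_prev[OF \<open>N \<ge> 1\<close>, of "\<lambda>n. V (Q n s)" for s]
    by (intro sum_integral_eq_0 continuous_intros VQ prev_in) (simp_all add: sum_subtractf)
  \<comment> \<open>Both shifted sums equal the unshifted one, so the coefficients 1, -2, 1
    cancel.\<close>
  have damping: "(\<Sum>n=1..N. integral {0..t}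
      (\<lambda>s. \<beta> * (p (cyc_next N n) s - 2 * p n s + p (cyc_prev N n) s))) = 0"
    using sum_cyc_prev[OF \<open>N \<ge> 1\<close>, of "\<lambda>n. p n s" for s]
      sum_cyc_next[OF \<open>N \<ge> 1\<close>, of "\<lambda>n. p n s" for s]
    by (intro sum_integral_eq_0 continuous_intros p prev_in next_in)
      (simp_all add: sum_subtractf sum.distrib flip: sum_distrib_left)
  have "(\<Sum>n=1..N. p n t) = (\<Sum>n=1..N. p n 0
      + integral {0..t} (\<lambda>s. V (Q n s) - V (Q (cyc_prev N n) s))
      + integral {0..t} (\<lambda>s. \<beta> * (p (cyc_next N n) s - 2 * p n s + p (cyc_prev N n) s))
      + \<sigma> * (w n t - w n 0))"
    by (rule sum.cong[OF refl eq])
  then show ?thesis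
    using force damping by (simp add: sum.distrib flip: sum_distrib_left)
qed

text \<open>Independence on two levels: the probability of a box of events factors first over
  \<open>n\<close>, because the rows are independent as vectors, and then over \<open>i\<close>
  inside each row. Boxes indexed by all of \<open>I \<times> J\<close> suffice to test independence
  of a finite family.\<close>

lemma (in prob_space) indep_vars_pairs:
  assumes fin: "finite I" "finite J"
    and outer: "indep_vars (\<lambda>_. PiM J N) (\<lambda>n \<omega>. \<lambda>i\<in>J. X n i \<omega>) I"
    and inner: "\<And>n. n \<in> I \<Longrightarrow> indep_vars N (X n) J"
  shows "indep_vars (\<lambda>(n, i). N i) (\<lambda>(n, i). X n i) (I \<times> J)"
proof (cases "I = {} \<or> J = {}")
  case True
  then show ?thesis by (auto simp: indep_vars_def indep_sets_def)
next
  case False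
  have rv: "random_variable (N i) (X n i)" if "n \<in> I" "i \<in> J" for n i
    using inner[OF that(1)] that(2) by (auto simp: indep_vars_def)
  show ?thesis
  proof (subst indep_vars_finite[where E = "\<lambda>(n, i). sets (N i)"], goal_cases)
    \<comment> \<open>This case is the product formula itself. The remaining ones are side
      conditions of the criterion, where each sigma-algebra serves as its own intersection-stable
      generator.\<close>
    case 8
    show ?case
    proof
      fix A assume A: "A \<in> (\<Pi> k\<in>I \<times> J. case k of (n, i) \<Rightarrow> sets (N i))"
      then have A_sets: "A (n, i) \<in> sets (N i)" if "n \<in> I" "i \<in> J" for n i
        using that by (auto simp: Pi_iff)
      \<comment> \<open>The bridge between the levels: an event of the row vector is an intersection
        of events of its entries. Nonemptiness of \<open>J\<close> keeps that intersection inside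
        \<open>space M\<close>.\<close>
      have box: "(\<lambda>\<omega>. \<lambda>i\<in>J. X n i \<omega>) -` (PiE J (\<lambda>i. A (n, i))) \<inter> space M
          = (\<Inter>i\<in>J. X n i -` A (n, i) \<inter> space M)" for n
        using False by (auto simp: PiE_iff)
      have "prob (\<Inter>k\<in>I \<times> J. (case k of (n, i) \<Rightarrow> X n i) -` A k \<inter> space M)
          = prob (\<Inter>n\<in>I. (\<lambda>\<omega>. \<lambda>i\<in>J. X n i \<omega>) -` (PiE J (\<lambda>i. A (n, i))) \<inter> space M)"
        unfolding box by (rule arg_cong[where f = prob]) (use False in auto)
      also have "\<dots> = (\<Prod>n\<in>I. prob ((\<lambda>\<omega>. \<lambda>i\<in>J. X n i \<omega>) -` (PiE J (\<lambda>i. A (n, i))) \<inter> space M))"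
        using False fin A_sets by (intro indep_varsD_finite[OF outer] sets_PiM_I_finite) auto
      also have "\<dots> = (\<Prod>n\<in>I. \<Prod>i\<in>J. prob (X n i -` A (n, i) \<inter> space M))"
        unfolding box using False fin A_sets
        by (intro prod.cong refl indep_varsD_finite[OF inner]) auto
      also have "\<dots> = (\<Prod>k\<in>I \<times> J. prob ((case k of (n, i) \<Rightarrow> X n i) -` A k \<inter> space M))"
        by (simp add: prod.cartesian_product case_prod_beta)
      finally show "prob (\<Inter>k\<in>I \<times> J. (case k of (n, i) \<Rightarrow> X n i) -` A k \<inter> space M)
          = (\<Prod>k\<in>I \<times> J. prob ((case k of (n, i) \<Rightarrow> X n i) -` A k \<inter> space M))" .
    qed
  qed (use False fin rv in \<open>auto simp: sets.sigma_sets_eq sets.Int_stable dest: sets.sets_into_space\<close>)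
qed

text \<open>The columns \<open>I \<times> {j}\<close> are disjoint blocks of indices, hence
  independent as vectors, and each sum is a measurable function of its own block.\<close>

lemma (in prob_space) indep_vars_sum_columns:
  fixes X :: "'i \<Rightarrow> 'j \<Rightarrow> 'a \<Rightarrow> real"
  assumes ind: "indep_vars (\<lambda>_. borel) (\<lambda>(n, i). X n i) (I \<times> J)"
  shows "indep_vars (\<lambda>_. borel) (\<lambda>i \<omega>. \<Sum>n\<in>I. X n i \<omega>) J"
proof -
  have "indep_vars (\<lambda>j. PiM (I \<times> {j}) (\<lambda>_. borel))
      (\<lambda>j \<omega>. \<lambda>k\<in>I \<times> {j}. (case k of (n, i) \<Rightarrow> X n i) \<omega>) J"
    by (rule indep_vars_restrict[OF ind]) (auto simp: disjoint_family_on_def)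
  then have "indep_vars (\<lambda>_. borel)
      (\<lambda>j \<omega>. (\<lambda>x. \<Sum>n\<in>I. x (n, j)) (\<lambda>k\<in>I \<times> {j}. (case k of (n, i) \<Rightarrow> X n i) \<omega>)) J"
    by (rule indep_vars_compose2)
       (auto intro!: borel_measurable_sum measurable_component_singleton)
  then show ?thesis
    by simp
qed

text \<open>The factor \<open>1 / sqrt (real N)\<close> normalises the variance of a sum of
  \<open>N\<close> independent components. Subtracting \<open>W n 0\<close>, which vanishes only
  almost surely, makes the process start at 0 for every outcome and matches the noise term of the
  system.\<close>

lemma standard_brownian_motion_scaled_sum:
  fixes W :: "nat \<Rightarrow> real \<Rightarrow> 'a \<Rightarrow> real"
  assumes W: "standard_brownian_motion_dim M N W" and "N \<ge> 1"
  shows "standard_brownian_motion M (\<lambda>t \<omega>. 1 / sqrt (real N) * (\<Sum>n=1..N. W n t \<omega> - W n 0 \<omega>))"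
    (is "standard_brownian_motion M ?B")
proof -
  have bm: "standard_brownian_motion M (W n)" if "n \<in> {1..N}" for n
    using W that by (simp add: standard_brownian_motion_dim_def)
  then interpret prob_space M
    using \<open>N \<ge> 1\<close> by (auto simp: standard_brownian_motion_def)
  have paths: "indep_vars (\<lambda>_. PiM {0..} (\<lambda>_. borel)) (\<lambda>n \<omega>. \<lambda>t\<in>{0..}. W n t \<omega>) {1..N}"
    using W by (simp add: standard_brownian_motion_dim_def)
  have meas: "W n t \<in> borel_measurable M" if "n \<in> {1..N}" "t \<ge> 0" for n t
    using bm that by (auto simp: standard_brownian_motion_def)
  have incr: "?B t \<omega> - ?B s \<omega> = 1 / sqrt (real N) * (\<Sum>n=1..N. W n t \<omega> - W n s \<omega>)" for s t \<omega>
    by (simp add: sum_subtractf flip: diff_divide_distrib)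

  have "?B t \<in> borel_measurable M" if "t \<ge> 0" for t
    using that by (intro borel_measurable_times borel_measurable_sum borel_measurable_diff meas) auto

  moreover have "indep_vars (\<lambda>_. borel) (\<lambda>i \<omega>. ?B (\<tau> (Suc i)) \<omega> - ?B (\<tau> i) \<omega>) {..<m}"
    if \<tau>: "0 \<le> \<tau> 0" "\<forall>i<m. \<tau> i \<le> \<tau> (Suc i)" for m :: nat and \<tau> :: "nat \<Rightarrow> real"
  proof -
    define X where "X n i \<omega> = W n (\<tau> (Suc i)) \<omega> - W n (\<tau> i) \<omega>" for n i \<omega>
    \<comment> \<open>Restricted paths carry values on \<open>{0..}\<close> only, so a time must be
      known to be nonnegative before it is evaluated. The bound includes \<open>i = m\<close>, the
      right end of the last increment.\<close>
    have nonneg: "0 \<le> \<tau> i" if "i \<le> m" for i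
      using that
    proof (induction i)
      case (Suc i)
      then have "0 \<le> \<tau> i" by simp
      also have "\<tau> i \<le> \<tau> (Suc i)" using Suc.prems \<tau>(2) by simp
      finally show ?case .
    qed (rule \<tau>(1))
    \<comment> \<open>The vector of increments of a component is a measurable function of its whole
      path, so independence of the paths passes to these vectors.\<close>
    have "indep_vars (\<lambda>_. PiM {..<m} (\<lambda>_. borel))
        (\<lambda>n \<omega>. (\<lambda>x. \<lambda>i\<in>{..<m}. x (\<tau> (Suc i)) - x (\<tau> i)) (\<lambda>t\<in>{0..}. W n t \<omega>)) {1..N}"
      by (rule indep_vars_compose2[OF paths], rule measurable_restrict)
        (auto intro!: borel_measurable_diff measurable_component_singleton nonneg)
    also have "?this \<longleftrightarrow> indep_vars (\<lambda>_. PiM {..<m} (\<lambda>_. borel)) (\<lambda>n \<omega>. \<lambda>i\<in>{..<m}. X n i \<omega>) {1..N}"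
      by (intro indep_vars_cong refl ext restrict_ext) (auto simp: X_def nonneg)
    finally have "indep_vars (\<lambda>(n, i). borel) (\<lambda>(n, i). X n i) ({1..N} \<times> {..<m})"
    proof (rule indep_vars_pairs[rotated 2])
      show "indep_vars (\<lambda>_. borel) (X n) {..<m}" if "n \<in> {1..N}" for n
        using bm[OF that] \<tau> unfolding standard_brownian_motion_def X_def by blast
    qed simp_all
    then have "indep_vars (\<lambda>_. borel) (\<lambda>i \<omega>. \<Sum>n=1..N. X n i \<omega>) {..<m}"
      by (intro indep_vars_sum_columns) (simp add: case_prod_beta')
    then have "indep_vars (\<lambda>_. borel) (\<lambda>i \<omega>. 1 / sqrt (real N) * (\<Sum>n=1..N. X n i \<omega>)) {..<m}"
      by (rule indep_vars_compose2) simp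
    then show ?thesis
      unfolding incr X_def .
  qed

  moreover have "distributed M lborel (\<lambda>\<omega>. ?B t \<omega> - ?B s \<omega>) (normal_density 0 (sqrt (t - s)))"
    if st: "0 \<le> s" "s < t" for s t
  proof -
    have "indep_vars (\<lambda>_. borel) (\<lambda>n \<omega>. (\<lambda>x. x t - x s) (\<lambda>t\<in>{0..}. W n t \<omega>)) {1..N}"
      using st by (intro indep_vars_compose2[OF paths])
        (auto intro!: borel_measurable_diff measurable_component_singleton)
    then have "indep_vars (\<lambda>_. borel) (\<lambda>n \<omega>. W n t \<omega> - W n s \<omega>) {1..N}"
      using st by simp
    moreover have "distributed M lborel (\<lambda>\<omega>. W n t \<omega> - W n s \<omega>) (normal_density 0 (sqrt (t - s)))"
      if "n \<in> {1..N}" for n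
      using bm[OF that] st by (simp add: standard_brownian_motion_def)
    \<comment> \<open>Variances of independent normal variables add up to
      \<open>N * (t - s)\<close>; the affine rescaling below brings the deviation back to
      \<open>sqrt (t - s)\<close>. Here \<open>s < t\<close> makes the deviations positive.\<close>
    ultimately have "distributed M lborel (\<lambda>\<omega>. \<Sum>n=1..N. W n t \<omega> - W n s \<omega>)
        (normal_density (\<Sum>n=1..N. 0) (sqrt (\<Sum>n=1..N. (sqrt (t - s))\<^sup>2)))"
      using st \<open>N \<ge> 1\<close> by (intro sum_indep_normal) auto
    then have "distributed M lborel (\<lambda>\<omega>. \<Sum>n=1..N. W n t \<omega> - W n s \<omega>)
        (normal_density 0 (sqrt (real N) * sqrt (t - s)))"
      using st by (simp add: real_sqrt_mult)
    from normal_density_affine[OF this, of "1 / sqrt (real N)" 0] show ?thesis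
      unfolding incr using st \<open>N \<ge> 1\<close> by simp
  qed

  moreover have "AE \<omega> in M. continuous_on {0..} (\<lambda>t. ?B t \<omega>)"
  proof -
    have "AE \<omega> in M. \<forall>n\<in>{1..N}. continuous_on {0..} (\<lambda>t. W n t \<omega>)"
      using bm by (intro AE_finite_allI) (auto simp: standard_brownian_motion_def)
    then show ?thesis
      by eventually_elim (intro continuous_intros, auto)
  qed

  ultimately show ?thesis
    using prob_space_axioms unfolding standard_brownian_motion_def by simp
qed

theorem mainTheorem6:
  fixes M :: "'a measure" and N :: nat and \<beta> \<sigma> :: real and U :: "real \<Rightarrow> real"
    and W Q p :: "nat \<Rightarrow> real \<Rightarrow> 'a \<Rightarrow> real" and Q0 p0 :: "nat \<Rightarrow> real"
  assumes "prob_space M"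
    and "N \<ge> 3" and "\<beta> > 0"
    and "U differentiable_on UNIV" and "continuous_on UNIV (deriv U)"
    and "\<forall>x. U x \<ge> 0" and "convex_on UNIV U"
    and "standard_brownian_motion_dim M N W"
    and "\<forall>n\<in>{1..N}. Q0 n \<ge> 0"
    and "solves_chain_system M N \<beta> \<sigma> U W Q0 p0 Q p"
  shows "(\<exists>B. standard_brownian_motion M B \<and>
            (AE \<omega> in M. \<forall>t\<ge>0. mean_velocity N p t \<omega> - mean_velocity N p 0 \<omega>
                                 = \<sigma> / sqrt (real N) * B t \<omega>)) \<and>
         (AE \<omega> in M. \<forall>t\<ge>0. mean_velocity N p t \<omega> - mean_velocity N p 0 \<omega>
                              = \<sigma> / real N * (\<Sum>n=1..N. W n t \<omega> - W n 0 \<omega>))"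
proof -
  have noise: "AE \<omega> in M. \<forall>t\<ge>0. mean_velocity N p t \<omega> - mean_velocity N p 0 \<omega>
      = \<sigma> / real N * (\<Sum>n=1..N. W n t \<omega> - W n 0 \<omega>)"
    \<comment> \<open>One event of full measure carries the equations for all \<open>n\<close> and
      \<open>t\<close> at once, so the exceptional null set does not depend on time.\<close>
    using conjunct2[OF assms(10)[unfolded solves_chain_system_def]]
  proof eventually_elim
    case (elim \<omega>)
    show ?case
    proof (intro allI impI)
      fix t :: real assume "t \<ge> 0"
      have "(\<Sum>n=1..N. p n t \<omega>) - (\<Sum>n=1..N. p n 0 \<omega>) = \<sigma> * (\<Sum>n=1..N. W n t \<omega> - W n 0 \<omega>)"
      proof (rule chain_sum_velocity[where V = "deriv U" and Q = "\<lambda>n t. Q n t \<omega>" and \<beta> = \<beta>])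
        fix n assume n: "n \<in> {1..N}"
        show "continuous_on {0..t} (\<lambda>t. Q n t \<omega>)" "continuous_on {0..t} (\<lambda>t. p n t \<omega>)"
          using elim n by (force intro: continuous_on_subset[of "{0..}"])+
        show "p n t \<omega> = p n 0 \<omega>
             + integral {0..t} (\<lambda>s. deriv U (Q n s \<omega>) - deriv U (Q (cyc_prev N n) s \<omega>))
             + integral {0..t} (\<lambda>s. \<beta> * (p (cyc_next N n) s \<omega> - 2 * p n s \<omega>
                                           + p (cyc_prev N n) s \<omega>))
             + \<sigma> * (W n t \<omega> - W n 0 \<omega>)"
          using elim n \<open>t \<ge> 0\<close> by blast
      qed (use assms(2,5) in auto)
      then show "mean_velocity N p t \<omega> - mean_velocity N p 0 \<omega>
          = \<sigma> / real N * (\<Sum>n=1..N. W n t \<omega> - W n 0 \<omega>)"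
        unfolding mean_velocity_def by (simp flip: right_diff_distrib diff_divide_distrib)
    qed
  qed
  \<comment> \<open>The witness \<open>B\<close> is built from \<open>W\<close> rather than by
    dividing the mean velocity by \<open>\<sigma>\<close>, so \<open>\<sigma> = 0\<close> is covered
    as well.\<close>
  have scale: "\<sigma> / sqrt (real N) * (1 / sqrt (real N) * x) = \<sigma> / real N * x" for x
    by simp
  have "standard_brownian_motion M (\<lambda>t \<omega>. 1 / sqrt (real N) * (\<Sum>n=1..N. W n t \<omega> - W n 0 \<omega>))"
    using assms(2) by (intro standard_brownian_motion_scaled_sum[OF assms(8)]) simp
  moreover have "AE \<omega> in M. \<forall>t\<ge>0. mean_velocity N p t \<omega> - mean_velocity N p 0 \<omega>
      = \<sigma> / sqrt (real N) * (1 / sqrt (real N) * (\<Sum>n=1..N. W n t \<omega> - W n 0 \<omega>))"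
    unfolding scale by (rule noise)
  ultimately show ?thesis
    using noise by (intro conjI exI[of _ "\<lambda>t \<omega>. 1 / sqrt (real N) * (\<Sum>n=1..N. W n t \<omega> - W n 0 \<omega>)"])
qed

end
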